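(* Let $I$ be an ideal of a commutative ring $R$. Then the following statements are equivalent. (i) $I$ is a lifting ideal of $R$. (ii) If $J_{1}J_{2}\subseteq I$ for some coprime ideals $J_{1}$ and $J_{2}$ of $R$, then there exists an idempotent $e\in R$ such that $e\in I+J_{1}$ and $1-e\in I+J_{2}$. (iii) If $I=J_{1}J_{2}$ for some coprime ideals $J_{1}$ and $J_{2}$ of $R$, then there exists an idempotent $e\in R$ such that $e\in J_{1}$ and $1-e\in J_{2}$. (iv) The canonical ring map $R\rightarrow R[x]/J$ lifts idempotents, where $J$ is the kernel of the ring map $R[x]\rightarrow R/I$ given by $f(x)\mapsto f(0)+I$. (v) For every maximal ideal $\mathfrak{m}$ of $R$, the quotient ring $R/(I+\mathfrak{m}^{\ast})$ has no nontrivial idempotents.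
   Context: All rings are commutative with $1$. A morphism of rings $\phi:R\rightarrow R'$ lifts idempotents if for every idempotent $e'\in R'$ there exists an idempotent $e\in R$ with $\phi(e)=e'$. An ideal $I$ of $R$ is a lifting ideal of $R$ if the canonical map $R\rightarrow R/I$ lifts idempotents; equivalently, whenever $f\in R$ satisfies $f-f^{2}\in I$, there exists an idempotent $e\in R$ with $f-e\in I$. Ideals $J_1,J_2$ are coprime if $J_1+J_2=R$. For an ideal $K$ of $R$, $K^{\ast}$ denotes the ideal of $R$ generated by all idempotents of $R$ lying in $K$. A ring has no nontrivial idempotents if every idempotent is $0$ or $1$ (the zero ring is allowed). *)

theory Defs
  imports "HOL-Algebra.Algebra"
begin

definition idempotents :: "('a, 'm) ring_scheme \<Rightarrow> 'a set" where
  "idempotents R = {e \<in> carrier R. e \<otimes>\<^bsub>R\<^esub> e = e}"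

definition lifts_idempotents ::
    "('a, 'm) ring_scheme \<Rightarrow> ('b, 'n) ring_scheme \<Rightarrow> ('a \<Rightarrow> 'b) \<Rightarrow> bool" where
  "lifts_idempotents R S \<phi> \<longleftrightarrow> (\<forall>e' \<in> idempotents S. \<exists>e \<in> idempotents R. \<phi> e = e')"

definition lifting_ideal :: "'a set \<Rightarrow> ('a, 'm) ring_scheme \<Rightarrow> bool" where
  "lifting_ideal I R \<longleftrightarrow> ideal I R \<and> lifts_idempotents R (R Quot I) (\<lambda>r. I +>\<^bsub>R\<^esub> r)"

definition coprime_ideals :: "('a, 'm) ring_scheme \<Rightarrow> 'a set \<Rightarrow> 'a set \<Rightarrow> bool" where
  "coprime_ideals R J\<^sub>1 J\<^sub>2 \<longleftrightarrow> ideal J\<^sub>1 R \<and> ideal J\<^sub>2 R \<and> J\<^sub>1 <+>\<^bsub>R\<^esub> J\<^sub>2 = carrier R"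

text \<open>The ideal written \<open>K\<^sup>*\<close> for an ideal \<open>K\<close>.\<close>

definition idempotent_part :: "('a, 'm) ring_scheme \<Rightarrow> 'a set \<Rightarrow> 'a set" where
  "idempotent_part R K = Idl\<^bsub>R\<^esub> (idempotents R \<inter> K)"

definition no_nontrivial_idempotents :: "('a, 'm) ring_scheme \<Rightarrow> bool" where
  "no_nontrivial_idempotents R \<longleftrightarrow> idempotents R \<subseteq> {\<zero>\<^bsub>R\<^esub>, \<one>\<^bsub>R\<^esub>}"

text \<open>The kernel of \<open>R[x] \<rightarrow> R/I\<close>, \<open>f \<mapsto> f(0) + I\<close>. Here \<open>f(0)\<close> is evaluation at zero, i.e.
  \<^const>\<open>eval\<close> along the identity of \<open>R\<close>.\<close>

definition eval0_kernel :: "('a, 'm) ring_scheme \<Rightarrow> 'a set \<Rightarrow> (nat \<Rightarrow> 'a) set" where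
  "eval0_kernel R I =
     a_kernel (UP R) (R Quot I) (\<lambda>f. I +>\<^bsub>R\<^esub> eval R R id \<zero>\<^bsub>R\<^esub> f)"

end

theory Submission
  imports Defs
begin

text \<open>Lifting an idempotent modulo \<open>I\<close> means: every \<open>f\<close> with \<open>f\<^sup>2 - f \<in> I\<close> is congruent modulo \<open>I\<close>
  to an idempotent. For (iii) \<open>\<Longrightarrow>\<close> (i) take \<open>J\<^sub>1 = I + Rf\<close> and \<open>J\<^sub>2 = I + R(1 - f)\<close>, whose product is
  \<open>I\<close>. In (iv), a polynomial is congruent to its constant term modulo \<open>J\<close>, so the condition is literally (i).
  For (i) \<open>\<Longrightarrow>\<close> (v), an element of \<open>\<mm>\<^sup>*\<close> is killed by an idempotent \<open>c\<close> with \<open>1 - c \<in> \<mm>\<close>; lift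
  \<open>cf\<close>. For (v) \<open>\<Longrightarrow>\<close> (i), the idempotents \<open>c\<close> for which \<open>f\<close> can be lifted on the
  component \<open>(1 - c)R\<close> are closed under products because lifts on orthogonal components can be glued;
  the elements killed by some such \<open>c\<close> form an ideal, and (v) shows that no maximal ideal contains it.
  So \<open>c = 0\<close> is allowed, and \<open>f\<close> lifts.\<close>

section \<open>Idempotents, their complements and gluing\<close>

context cring
begin

lemma idempotents_iff: "e \<in> idempotents R \<longleftrightarrow> e \<in> carrier R \<and> e \<otimes> e = e"
  by (simp add: idempotents_def)

lemma complement_idempotent:
  assumes "e \<in> idempotents R" shows "\<one> \<ominus> e \<in> idempotents R"
proof -
  have e: "e \<in> carrier R" "e \<otimes> e = e" using assms by (auto simp: idempotents_iff)
  \<comment> \<open>The defect \<open>e \<otimes> e \<ominus> e\<close> is split off by an identity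
    of commutative rings; idempotency enters only afterwards. Later computations follow the same
    pattern.\<close>
  have "(\<one> \<ominus> e) \<otimes> (\<one> \<ominus> e) = (\<one> \<ominus> e) \<oplus> (e \<otimes> e \<ominus> e)" using e(1) by algebra
  also have "\<dots> = \<one> \<ominus> e" using e by (simp add: minus_eq r_neg)
  finally show ?thesis using e by (simp add: idempotents_iff)
qed

lemma idempotent_mult_complement:
  assumes "e \<in> idempotents R" shows "e \<otimes> (\<one> \<ominus> e) = \<zero>"
proof -
  have e: "e \<in> carrier R" "e \<otimes> e = e" using assms by (auto simp: idempotents_iff)
  have "e \<otimes> (\<one> \<ominus> e) = e \<ominus> e \<otimes> e" using e(1) by algebra
  then show ?thesis using e by (simp add: minus_eq r_neg)
qed

lemma idempotent_mult:
  assumes "e \<in> idempotents R" "f \<in> idempotents R" shows "e \<otimes> f \<in> idempotents R"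
proof -
  have e: "e \<in> carrier R" "e \<otimes> e = e" "f \<in> carrier R" "f \<otimes> f = f"
    using assms by (auto simp: idempotents_iff)
  have "e \<otimes> f \<otimes> (e \<otimes> f) = (e \<otimes> e) \<otimes> (f \<otimes> f)" using e(1,3) by algebra
  then show ?thesis using e by (simp add: idempotents_iff)
qed

text \<open>\<open>c\<close> and \<open>\<one> \<ominus> c\<close> are orthogonal, so the cross
  terms of the square vanish. The result agrees with \<open>g\<close> on the component of
  \<open>\<one> \<ominus> c\<close> and with \<open>h\<close> on that of \<open>c\<close>.\<close>

lemma glue_idempotents:
  assumes "c \<in> idempotents R" "g \<in> idempotents R" "h \<in> idempotents R"
  shows "(\<one> \<ominus> c) \<otimes> g \<oplus> c \<otimes> h \<in> idempotents R"
proof -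
  have car: "c \<in> carrier R" "g \<in> carrier R" "h \<in> carrier R"
    using assms by (auto simp: idempotents_iff)
  define d where "d = \<one> \<ominus> c"
  have d: "d \<in> carrier R" "d \<in> idempotents R" "c \<otimes> d = \<zero>"
    using car complement_idempotent[OF assms(1)] idempotent_mult_complement[OF assms(1)] by (simp_all add: d_def)
  have "(d \<otimes> g \<oplus> c \<otimes> h) \<otimes> (d \<otimes> g \<oplus> c \<otimes> h)
     = (d \<otimes> d) \<otimes> (g \<otimes> g) \<oplus> (c \<otimes> c) \<otimes> (h \<otimes> h) \<oplus> (c \<otimes> d) \<otimes> (g \<otimes> h \<oplus> g \<otimes> h)"
    using car d(1) by algebra
  also have "\<dots> = d \<otimes> g \<oplus> c \<otimes> h" using assms d car by (simp add: idempotents_iff)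
  finally show ?thesis using car d(1) by (simp add: idempotents_iff flip: d_def)
qed
end

section \<open>Idempotents of a quotient in terms of representatives\<close>

lemma (in ideal) minus_mem: "x \<in> I \<Longrightarrow> y \<in> I \<Longrightarrow> x \<ominus> y \<in> I"
  by (simp add: minus_eq)

lemma (in ring) set_add_iff: "x \<in> A <+> B \<longleftrightarrow> (\<exists>a\<in>A. \<exists>b\<in>B. x = a \<oplus> b)"
  by (auto simp: set_add_def')

context ideal
begin

lemma coset_eq_iff:
  assumes "a \<in> carrier R" "b \<in> carrier R"
  shows "I +> a = I +> b \<longleftrightarrow> a \<ominus> b \<in> I"
  using assms quotient_eq_iff_same_a_r_cos ideal_axioms by metis

lemma coset_eq_ideal_iff:
  assumes "a \<in> carrier R"
  shows "I +> a = I \<longleftrightarrow> a \<in> I"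
  using assms coset_eq_iff[of a \<zero>] a_coset_add_zero[OF a_subset]
  by (simp add: minus_eq)

lemma coset_idempotent_iff:
  assumes "f \<in> carrier R"
  shows "I +> f \<in> idempotents (R Quot I) \<longleftrightarrow> f \<otimes> f \<ominus> f \<in> I"
  using assms
  by (simp add: idempotents_def FactRing_def rcoset_mult_add coset_eq_iff a_rcosetsI a_subset)

text \<open>Every element of the quotient is a coset \<open>I +> f\<close>. With \<open>P\<close>
  arbitrary, one translation serves both the lifting condition and the absence of nontrivial
  idempotents.\<close>

lemma ball_idempotents_quotient:
  "(\<forall>E \<in> idempotents (R Quot I). P E) \<longleftrightarrow> (\<forall>f \<in> carrier R. f \<otimes> f \<ominus> f \<in> I \<longrightarrow> P (I +> f))"
  using coset_idempotent_iff
  by (auto simp: idempotents_def FactRing_def A_RCOSETS_def')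

lemma no_nontrivial_idempotents_quotient_iff:
  "no_nontrivial_idempotents (R Quot I) \<longleftrightarrow>
    (\<forall>f \<in> carrier R. f \<otimes> f \<ominus> f \<in> I \<longrightarrow> f \<in> I \<or> f \<ominus> \<one> \<in> I)"
  unfolding no_nontrivial_idempotents_def subset_eq ball_idempotents_quotient
  by (auto simp: FactRing_def coset_eq_iff coset_eq_ideal_iff)

text \<open>\<open>S\<close> and \<open>\<phi>\<close> are kept general to cover both the identity
  map, as in (i), and the embedding of constants into a polynomial ring, as in (iv).\<close>

lemma lifts_idempotents_quotient_iff:
  assumes "\<And>e. e \<in> idempotents S \<Longrightarrow> \<phi> e \<in> carrier R"
  shows "lifts_idempotents S (R Quot I) (\<lambda>r. I +> \<phi> r) \<longleftrightarrow>
    (\<forall>f \<in> carrier R. f \<otimes> f \<ominus> f \<in> I \<longrightarrow> (\<exists>e \<in> idempotents S. \<phi> e \<ominus> f \<in> I))"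
  unfolding lifts_idempotents_def ball_idempotents_quotient
  using assms by (auto simp: coset_eq_iff)
end

lemma (in cring) lifting_ideal_iff:
  assumes "ideal I R"
  shows "lifting_ideal I R \<longleftrightarrow>
    (\<forall>f \<in> carrier R. f \<otimes> f \<ominus> f \<in> I \<longrightarrow> (\<exists>e \<in> idempotents R. e \<ominus> f \<in> I))"
  using ideal.lifts_idempotents_quotient_iff[OF assms, of R "\<lambda>x. x"] assms
  by (simp add: lifting_ideal_def idempotents_iff)

section \<open>Maximal ideals and annihilation by idempotents\<close>

lemma (in ring) proper_ideal_maximal:
  assumes "ideal J R" "\<one> \<notin> J"
  obtains M where "maximalideal M R" "J \<subseteq> M"
proof -
  \<comment> \<open>Properness is stated as \<open>\<one> \<notin> K\<close>, which unions of chains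
    inherit, so Zorn applies.\<close>
  define A where "A = {K. ideal K R \<and> J \<subseteq> K \<and> \<one> \<notin> K}"
  have "\<exists>M\<in>A. \<forall>K\<in>A. M \<subseteq> K \<longrightarrow> K = M"
  proof (rule subset_Zorn_nonempty)
    show "A \<noteq> {}" using assms by (auto simp: A_def)
    fix C assume C: "C \<noteq> {}" "subset.chain A C"
    then have "subset.chain {K. ideal K R} C" by (auto simp: A_def pred_on.chain_def)
    from chain_Union_is_ideal[OF this] C show "\<Union>C \<in> A" by (auto simp: A_def pred_on.chain_def)
  qed
  then obtain M where M: "M \<in> A" and max: "\<And>K. K \<in> A \<Longrightarrow> M \<subseteq> K \<Longrightarrow> K = M" by blast
  have "maximalideal M R"
  proof (rule maximalidealI)
    show "ideal M R" "carrier R \<noteq> M" using M by (auto simp: A_def)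
    fix K assume "ideal K R" "M \<subseteq> K"
    then show "K = M \<or> K = carrier R"
      using max[of K] M ideal.one_imp_carrier by (auto simp: A_def)
  qed
  then show thesis using that M by (auto simp: A_def)
qed

text \<open>This is the kernel of the localization map at the multiplicative set \<open>T\<close>:
  if \<open>c\<close> kills \<open>a\<close> and \<open>d\<close> kills \<open>b\<close>, then
  \<open>c \<otimes> d\<close> kills \<open>a \<oplus> b\<close>. It is used for two different sets
  of idempotents.\<close>

lemma (in cring) annihilated_ideal:
  assumes T: "T \<subseteq> carrier R" "\<one> \<in> T" "\<And>c d. c \<in> T \<Longrightarrow> d \<in> T \<Longrightarrow> c \<otimes> d \<in> T"
  shows "ideal {x \<in> carrier R. \<exists>c\<in>T. c \<otimes> x = \<zero>} R" (is "ideal ?N R")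
proof -
  have l: "y \<otimes> x \<in> ?N" if x: "x \<in> ?N" and y: "y \<in> carrier R" for x y
  proof -
    obtain c where c: "c \<in> T" "c \<otimes> x = \<zero>" "x \<in> carrier R" using x by auto
    then have "c \<otimes> (y \<otimes> x) = \<zero>" using T(1) y by (metis m_lcomm r_null subsetD)
    then show ?thesis using c y by auto
  qed
  show ?thesis
  proof (rule idealI)
    show "ring R" by (rule ring_axioms)
  next
    fix x y assume x: "x \<in> ?N" and y: "y \<in> carrier R"
    show "y \<otimes> x \<in> ?N" using x y by (rule l)
    moreover have "x \<otimes> y = y \<otimes> x" using x y by (intro m_comm) auto
    ultimately show "x \<otimes> y \<in> ?N" by simp
  next
    show "subgroup ?N (add_monoid R)"
    proof (rule add.subgroupI)
      show "?N \<noteq> {}" using T(2) by force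
      show "\<ominus> a \<in> ?N" if "a \<in> ?N" for a
        using l[of a "\<ominus> \<one>"] that by (auto simp: l_minus)
      show "a \<oplus> b \<in> ?N" if ab: "a \<in> ?N" "b \<in> ?N" for a b
      proof -
        obtain c d where c: "c \<in> T" "c \<otimes> a = \<zero>" "a \<in> carrier R" and d: "d \<in> T" "d \<otimes> b = \<zero>" "b \<in> carrier R"
          using ab by auto
        have cd: "c \<in> carrier R" "d \<in> carrier R" using c d T(1) by auto
        have "c \<otimes> d \<otimes> (a \<oplus> b) = d \<otimes> (c \<otimes> a) \<oplus> c \<otimes> (d \<otimes> b)" using c(3) d(3) cd by algebra
        then show ?thesis using c d cd T(3) by auto
      qed
    qed auto
  qed
qed

text \<open>The idempotents congruent to \<open>\<one>\<close> modulo \<open>M\<close> are closed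
  under products, so the elements they annihilate form an ideal. It contains each idempotent
  \<open>e\<close> of \<open>M\<close>, killed by \<open>\<one> \<ominus> e\<close>, hence all of
  \<open>idempotent_part R M\<close>.\<close>

lemma (in cring) idempotent_part_annihilated:
  assumes "ideal M R" "x \<in> idempotent_part R M"
  obtains c where "c \<in> idempotents R" "\<one> \<ominus> c \<in> M" "c \<otimes> x = \<zero>"
proof -
  interpret M: ideal M R by fact
  define T where "T = {c \<in> idempotents R. \<one> \<ominus> c \<in> M}"
  have "ideal {x \<in> carrier R. \<exists>c\<in>T. c \<otimes> x = \<zero>} R"
  proof (rule annihilated_ideal)
    show "T \<subseteq> carrier R" "\<one> \<in> T" by (auto simp: T_def idempotents_iff minus_eq r_neg)
    fix c d assume cd: "c \<in> T" "d \<in> T"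
    then have car: "c \<in> carrier R" "d \<in> carrier R" by (auto simp: T_def idempotents_iff)
    have "\<one> \<ominus> c \<otimes> d = (\<one> \<ominus> c) \<oplus> c \<otimes> (\<one> \<ominus> d)" using car by algebra
    then show "c \<otimes> d \<in> T" using cd car by (simp add: T_def idempotent_mult M.I_l_closed)
  qed
  moreover have "idempotents R \<inter> M \<subseteq> {x \<in> carrier R. \<exists>c\<in>T. c \<otimes> x = \<zero>}"
  proof
    fix e assume e: "e \<in> idempotents R \<inter> M"
    then have car: "e \<in> carrier R" by (auto simp: idempotents_iff)
    have "\<one> \<ominus> (\<one> \<ominus> e) = e" using car by algebra
    then have "\<one> \<ominus> e \<in> T" using e complement_idempotent by (auto simp: T_def)
    moreover have "(\<one> \<ominus> e) \<otimes> e = \<zero>" using idempotent_mult_complement[of e] e car by (simp add: m_comm)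
    ultimately show "e \<in> {x \<in> carrier R. \<exists>c\<in>T. c \<otimes> x = \<zero>}" using car by auto
  qed
  ultimately have "idempotent_part R M \<subseteq> {x \<in> carrier R. \<exists>c\<in>T. c \<otimes> x = \<zero>}"
    unfolding idempotent_part_def by (rule genideal_minimal)
  then show thesis using assms(2) that by (auto simp: T_def)
qed

lemma (in cring) idempotent_part_ideal: "ideal (idempotent_part R M) R"
  unfolding idempotent_part_def by (rule genideal_ideal) (auto simp: idempotents_iff)

lemma (in cring) idempotent_partI: "e \<in> idempotents R \<Longrightarrow> e \<in> M \<Longrightarrow> e \<in> idempotent_part R M"
  unfolding idempotent_part_def by (simp add: genideal_def subset_iff)

text \<open>Evaluation at zero is a ring homomorphism from \<open>UP R\<close> to \<open>R\<close>,
  and the kernel is the preimage of \<open>I\<close> under it.\<close>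

lemma (in cring) eval0_kernel_iff:
  assumes "ideal I R"
  shows "ideal (eval0_kernel R I) (UP R)"
    and "f \<in> eval0_kernel R I \<longleftrightarrow> f \<in> carrier (UP R) \<and> UnivPoly.eval R R id \<zero> f \<in> I"
proof -
  interpret I: ideal I R by fact
  interpret E: UP_pre_univ_prop R R id "UP R"
    by (auto intro!: UP_pre_univ_propI is_cring ring_hom_memI)
  have ev: "UnivPoly.eval R R id \<zero> \<in> ring_hom (UP R) R" using E.eval_ring_hom by simp
  have mem: "f \<in> eval0_kernel R I \<longleftrightarrow> f \<in> carrier (UP R) \<and> UnivPoly.eval R R id \<zero> f \<in> I" for f
    using ring_hom_closed[OF ev]
    by (cases "f \<in> carrier (UP R)")
      (simp_all add: eval0_kernel_def a_kernel_def' FactRing_def I.coset_eq_ideal_iff)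
  then show "f \<in> eval0_kernel R I \<longleftrightarrow> f \<in> carrier (UP R) \<and> UnivPoly.eval R R id \<zero> f \<in> I" .
  interpret H: ring_hom_ring "UP R" R "UnivPoly.eval R R id \<zero>"
    using ev by (intro ring_hom_ringI2) (simp_all add: ring_axioms E.UP_ring)
  have "eval0_kernel R I = {f \<in> carrier (UP R). UnivPoly.eval R R id \<zero> f \<in> I}" using mem by blast
  then show "ideal (eval0_kernel R I) (UP R)" using H.ideal_vimage[OF assms] by simp
qed

section \<open>Products of coprime ideals: conditions (ii) and (iii)\<close>

context cring
begin

text \<open>Write \<open>\<one> = a \<oplus> b\<close> with \<open>a\<close> in \<open>J\<close> and
  \<open>b\<close> in \<open>K\<close>. Then \<open>a\<close> is idempotent modulo \<open>I\<close>,
  and if \<open>e\<close> lifts it, \<open>e\<close> is congruent to \<open>a\<close> and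
  \<open>\<one> \<ominus> e\<close> to \<open>b\<close>.\<close>

lemma lifting_ideal_imp_coprime:
  assumes "ideal I R" "lifting_ideal I R" "coprime_ideals R J K" "J \<cdot> K \<subseteq> I"
  shows "\<exists>e \<in> idempotents R. e \<in> I <+> J \<and> \<one> \<ominus> e \<in> I <+> K"
proof -
  interpret I: ideal I R by fact
  interpret J: ideal J R using assms(3) by (simp add: coprime_ideals_def)
  interpret K: ideal K R using assms(3) by (simp add: coprime_ideals_def)
  have "\<one> \<in> J <+> K" using assms(3) by (simp add: coprime_ideals_def)
  then obtain a b where ab: "a \<in> J" "b \<in> K" "\<one> = a \<oplus> b" by (auto simp: set_add_iff)
  have car: "a \<in> carrier R" "b \<in> carrier R" using ab by auto
  have "a \<otimes> b \<in> I" using assms(4) ab by (auto intro: ideal_prod.prod)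
  moreover have "a \<otimes> a \<ominus> a = \<ominus> (a \<otimes> b)"
  proof -
    have "a \<otimes> a \<ominus> a = a \<otimes> a \<ominus> a \<otimes> (a \<oplus> b)" using car ab(3) by (metis r_one)
    also have "\<dots> = \<ominus> (a \<otimes> b)" using car by algebra
    finally show ?thesis .
  qed
  ultimately have "a \<otimes> a \<ominus> a \<in> I" by simp
  then obtain e where e: "e \<in> idempotents R" "e \<ominus> a \<in> I"
    using assms(2) car lifting_ideal_iff[OF assms(1)] by blast
  have ec: "e \<in> carrier R" using e by (simp add: idempotents_iff)
  have "e = (e \<ominus> a) \<oplus> a" using ec car by algebra
  moreover have "\<one> \<ominus> e = \<ominus> (e \<ominus> a) \<oplus> b" unfolding ab(3) using ec car by algebra
  ultimately show ?thesis using e ab unfolding set_add_iff by (meson I.a_inv_closed)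
qed

lemma ideal_add_absorb:
  assumes "ideal I R" "ideal J R" "I \<subseteq> J"
  shows "I <+> J = J"
proof -
  interpret I: ideal I R by fact
  interpret J: ideal J R by fact
  have "x \<in> I <+> J" if "x \<in> J" for x :: 'a
    using that I.zero_closed J.Icarr[OF that] l_zero[of x] unfolding set_add_iff by metis
  then show ?thesis using assms(3) J.a_closed by (auto simp: set_add_iff subset_iff)
qed

lemma mem_add_PIdl_iff: "x \<in> I <+> PIdl a \<longleftrightarrow> (\<exists>i\<in>I. \<exists>r\<in>carrier R. x = i \<oplus> r \<otimes> a)"
  by (auto simp: set_add_iff cgenideal_def)

text \<open>Modulo \<open>I\<close> such an \<open>x\<close> is a multiple of \<open>f\<close>, and
  \<open>f \<otimes> (\<one> \<ominus> f)\<close> vanishes there.\<close>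

lemma add_PIdl_mult_complement:
  fixes x :: 'a
  assumes I: "ideal I R" and f: "f \<in> carrier R" "f \<otimes> f \<ominus> f \<in> I" and x: "x \<in> I <+> PIdl f"
  shows "x \<otimes> (\<one> \<ominus> f) \<in> I"
proof -
  interpret I: ideal I R by fact
  obtain i r where ir: "i \<in> I" "r \<in> carrier R" "x = i \<oplus> r \<otimes> f"
    using x by (auto simp: mem_add_PIdl_iff)
  have "x \<otimes> (\<one> \<ominus> f) = i \<otimes> (\<one> \<ominus> f) \<ominus> r \<otimes> (f \<otimes> f \<ominus> f)"
    unfolding ir(3) using I.Icarr[OF ir(1)] ir(2) f(1) by algebra
  then show ?thesis using ir f by (simp add: I.minus_mem I.I_l_closed I.I_r_closed)
qed

lemma lifting_ideal_if_coprime: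
  assumes I: "ideal I R"
    and lift: "\<And>J K. coprime_ideals R J K \<Longrightarrow> I = J \<cdot> K \<Longrightarrow> \<exists>e \<in> idempotents R. e \<in> J \<and> \<one> \<ominus> e \<in> K"
  shows "lifting_ideal I R"
  unfolding lifting_ideal_iff[OF I]
proof (intro ballI impI)
  interpret I: ideal I R by fact
  fix f assume f: "f \<in> carrier R" "f \<otimes> f \<ominus> f \<in> I"
  define g where "g = \<one> \<ominus> f"
  have g: "g \<in> carrier R" using f by (simp add: g_def)
  \<comment> \<open>The complement has the same defect, so \<open>f\<close> and \<open>g\<close>
    play symmetric roles from here on.\<close>
  have "g \<otimes> g \<ominus> g = f \<otimes> f \<ominus> f" unfolding g_def using f(1) by algebra
  then have gI: "g \<otimes> g \<ominus> g \<in> I" using f by simp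
  have fg: "\<one> \<ominus> g = f" "f \<oplus> g = \<one>" unfolding g_def using f(1) by algebra+
  define J :: "'a set" where "J = I <+> PIdl f"
  define K :: "'a set" where "K = I <+> PIdl g"
  have J: "ideal J R" and K: "ideal K R" unfolding J_def K_def
    using f g I by (auto intro!: add_ideals cgenideal_ideal)
  interpret J: ideal J R by fact
  interpret K: ideal K R by fact
  have fJ: "f \<in> J" unfolding J_def mem_add_PIdl_iff
    by (intro bexI[of _ \<zero>] bexI[of _ \<one>]) (use f in simp_all)
  have gK: "g \<in> K" unfolding K_def mem_add_PIdl_iff
    by (intro bexI[of _ \<zero>] bexI[of _ \<one>]) (use g in simp_all)
  have IJ: "i \<in> J" and IK: "i \<in> K" if "i \<in> I" for i
    unfolding J_def K_def mem_add_PIdl_iff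
    by (intro bexI[of _ i] bexI[of _ \<zero>]; use that f g in simp)+
  have JK: "x \<otimes> g \<in> I" if "x \<in> J" for x
    using add_PIdl_mult_complement[OF I f] that by (simp add: J_def g_def)
  have KJ: "x \<otimes> f \<in> I" if "x \<in> K" for x
    using add_PIdl_mult_complement[OF I g gI] that by (simp add: K_def fg)
  have "coprime_ideals R J K"
  proof -
    have "\<one> \<in> J <+> K" unfolding set_add_iff using fJ gK fg by metis
    then show ?thesis
      using J K ideal.one_imp_carrier[OF add_ideals[OF J K]] by (simp add: coprime_ideals_def)
  qed
  moreover have "I = J \<cdot> K"
  proof
    show "I \<subseteq> J \<cdot> K"
    proof
      fix i assume i: "i \<in> I"
      have "i = i \<otimes> (f \<oplus> g)" using i fg by simp
      \<comment> \<open>The factors are ordered so that the left one lies in \<open>J\<close> and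
        the right one in \<open>K\<close>.\<close>
      also have "\<dots> = f \<otimes> i \<oplus> i \<otimes> g" using I.Icarr[OF i] f(1) g by algebra
      also have "\<dots> \<in> J \<cdot> K" using IJ[OF i] IK[OF i] fJ gK by (auto intro!: ideal_prod.intros)
      finally show "i \<in> J \<cdot> K" .
    qed
    show "J \<cdot> K \<subseteq> I"
    proof
      fix x assume "x \<in> J \<cdot> K"
      then show "x \<in> I"
      proof induction
        case (prod a b)
        have car: "a \<in> carrier R" "b \<in> carrier R" using prod by auto
        \<comment> \<open>Splitting \<open>\<one>\<close> as \<open>f \<oplus> g\<close> pairs
          \<open>b\<close> with \<open>f\<close> and \<open>a\<close> with \<open>g\<close>, and
          both products lie in \<open>I\<close>.\<close>
        have "a \<otimes> b = a \<otimes> b \<otimes> (f \<oplus> g)" using car fg by simp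
        also have "\<dots> = a \<otimes> (b \<otimes> f) \<oplus> b \<otimes> (a \<otimes> g)" using car f(1) g by algebra
        also have "\<dots> \<in> I" using JK[OF prod(1)] KJ[OF prod(2)] car by (simp add: I.I_l_closed)
        finally show ?case .
      qed simp
    qed
  qed
  ultimately obtain e where e: "e \<in> idempotents R" "e \<in> J" "\<one> \<ominus> e \<in> K" using lift by blast
  have ec: "e \<in> carrier R" using e by (simp add: idempotents_iff)
  \<comment> \<open>Since \<open>e\<close> is in \<open>J\<close> and its complement in
    \<open>K\<close>, both terms lie in \<open>I\<close>.\<close>
  have "e \<ominus> f = e \<otimes> g \<ominus> (\<one> \<ominus> e) \<otimes> f" unfolding g_def using ec f(1) by algebra
  also have "\<dots> \<in> I" using JK KJ e by (simp add: I.minus_mem)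
  finally show "\<exists>e \<in> idempotents R. e \<ominus> f \<in> I" using e by blast
qed

section \<open>The polynomial ring: condition (iv)\<close>

lemma lifting_ideal_iff_eval0_kernel:
  assumes I: "ideal I R"
  shows "lifting_ideal I R \<longleftrightarrow>
        lifts_idempotents R (UP R Quot eval0_kernel R I)
          (\<lambda>r. eval0_kernel R I +>\<^bsub>UP R\<^esub> up_ring.monom (UP R) r 0)"
proof -
  interpret E: UP_pre_univ_prop R R id "UP R"
    by (auto intro!: UP_pre_univ_propI is_cring ring_hom_memI)
  interpret H: ring_hom_ring "UP R" R "UnivPoly.eval R R id \<zero>"
    using E.eval_ring_hom by (intro ring_hom_ringI2) (simp_all add: ring_axioms E.UP_ring)
  let ?v = "UnivPoly.eval R R id \<zero>"
  have const: "?v (up_ring.monom (UP R) r 0) = r" if "r \<in> carrier R" for r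
    using that E.eval_const by simp
  have minus: "?v (p \<ominus>\<^bsub>UP R\<^esub> q) = ?v p \<ominus> ?v q" if "p \<in> carrier (UP R)" "q \<in> carrier (UP R)" for p q
    using that by (simp add: a_minus_def)
  \<comment> \<open>Membership in the kernel is tested on values at zero, so \<open>p\<close> enters
    only through \<open>?v p\<close>.\<close>
  have "lifts_idempotents R (UP R Quot eval0_kernel R I)
          (\<lambda>r. eval0_kernel R I +>\<^bsub>UP R\<^esub> up_ring.monom (UP R) r 0) \<longleftrightarrow>
    (\<forall>p \<in> carrier (UP R). ?v p \<otimes> ?v p \<ominus> ?v p \<in> I \<longrightarrow> (\<exists>e \<in> idempotents R. e \<ominus> ?v p \<in> I))"
    by (subst ideal.lifts_idempotents_quotient_iff[OF eval0_kernel_iff(1)[OF I]])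
      (auto simp: eval0_kernel_iff(2)[OF I] idempotents_iff minus const)
  \<comment> \<open>Every element of \<open>R\<close> is the value at zero of its constant
    polynomial, so \<open>?v p\<close> ranges over all of \<open>R\<close>.\<close>
  also have "\<dots> \<longleftrightarrow> lifting_ideal I R"
    unfolding lifting_ideal_iff[OF I] using const E.monom_closed H.hom_closed by metis
  finally show ?thesis by simp
qed

section \<open>Maximal ideals: condition (v)\<close>

lemma lifting_ideal_imp_no_nontrivial_idempotents:
  assumes I: "ideal I R" and lift: "lifting_ideal I R" and M: "maximalideal M R"
  shows "no_nontrivial_idempotents (R Quot (I <+> idempotent_part R M))"
proof -
  interpret I: ideal I R by fact
  interpret M: primeideal M R using maximalideal_prime[OF M] .
  interpret P: ideal "idempotent_part R M" R by (rule idempotent_part_ideal)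
  define Q :: "'a set" where "Q = I <+> idempotent_part R M"
  interpret Q: ideal Q R unfolding Q_def by (rule add_ideals) unfold_locales
  have IQ: "x \<in> Q" if "x \<in> I" for x
    using that P.zero_closed r_zero[OF I.Icarr[OF that]] unfolding Q_def set_add_iff by metis
  have PQ: "x \<in> Q" if "x \<in> idempotent_part R M" for x
    using that I.zero_closed l_zero[OF P.Icarr[OF that]] unfolding Q_def set_add_iff by metis
  have "f \<in> Q \<or> f \<ominus> \<one> \<in> Q" if f: "f \<in> carrier R" "f \<otimes> f \<ominus> f \<in> Q" for f
  proof -
    obtain i x where ix: "i \<in> I" "x \<in> idempotent_part R M" "f \<otimes> f \<ominus> f = i \<oplus> x"
      using f unfolding Q_def set_add_iff by blast
    obtain c where c: "c \<in> idempotents R" "\<one> \<ominus> c \<in> M" "c \<otimes> x = \<zero>"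
      using idempotent_part_annihilated[OF M.ideal_axioms ix(2)] .
    have cc: "c \<in> carrier R" "c \<otimes> c = c" using c by (auto simp: idempotents_iff)
    \<comment> \<open>\<open>\<one> \<ominus> c\<close> is an idempotent of \<open>M\<close>, so
      \<open>c\<close> becomes \<open>\<one>\<close> modulo \<open>Q\<close>.\<close>
    have cQ: "\<one> \<ominus> c \<in> Q" using c by (intro PQ idempotent_partI complement_idempotent)
    \<comment> \<open>Multiplication by \<open>c\<close> kills \<open>x\<close>, which makes
      \<open>c \<otimes> f\<close> idempotent modulo \<open>I\<close> itself and not only modulo
      \<open>Q\<close>.\<close>
    have "(c \<otimes> f) \<otimes> (c \<otimes> f) \<ominus> c \<otimes> f = (c \<otimes> c) \<otimes> (f \<otimes> f) \<ominus> c \<otimes> f"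
      using f(1) cc(1) by algebra
    also have "\<dots> = c \<otimes> (f \<otimes> f \<ominus> f)" unfolding cc(2) using f(1) cc(1) by algebra
    also have "\<dots> = c \<otimes> i" using c(3) cc(1) I.Icarr[OF ix(1)] P.Icarr[OF ix(2)] by (simp add: ix(3) r_distr)
    also have "\<dots> \<in> I" using ix cc by (simp add: I.I_l_closed)
    finally obtain e where e: "e \<in> idempotents R" "e \<ominus> c \<otimes> f \<in> I"
      using lift f(1) cc(1) lifting_ideal_iff[OF I] m_closed by metis
    have ec: "e \<in> carrier R" using e by (simp add: idempotents_iff)
    have eQ: "e \<ominus> c \<otimes> f \<in> Q" "(\<one> \<ominus> c) \<otimes> f \<in> Q"
      using IQ[OF e(2)] cQ f by (simp_all add: Q.I_r_closed)
    \<comment> \<open>As \<open>M\<close> is prime, it contains \<open>e\<close> or its complement,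
      and then so does \<open>Q\<close>. Modulo \<open>Q\<close>, \<open>f\<close> equals
      \<open>c \<otimes> f\<close> and hence \<open>e\<close>, which is zero or one there.\<close>
    have "e \<otimes> (\<one> \<ominus> e) \<in> M" using e by (simp add: idempotent_mult_complement)
    then consider "e \<in> M" | "\<one> \<ominus> e \<in> M" using M.I_prime ec by blast
    then show ?thesis
    proof cases
      case 1
      then have "e \<in> Q" using e by (intro PQ idempotent_partI)
      moreover have "f = (\<one> \<ominus> c) \<otimes> f \<oplus> (e \<ominus> (e \<ominus> c \<otimes> f))" using f(1) cc(1) ec by algebra
      ultimately show ?thesis using eQ Q.minus_mem Q.a_closed by metis
    next
      case 2
      then have "\<one> \<ominus> e \<in> Q" using e by (intro PQ idempotent_partI complement_idempotent)
      moreover have "f \<ominus> \<one> = ((\<one> \<ominus> c) \<otimes> f \<ominus> (\<one> \<ominus> e)) \<ominus> (e \<ominus> c \<otimes> f)"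
        using f(1) cc(1) ec by algebra
      ultimately show ?thesis using eQ Q.minus_mem by metis
    qed
  qed
  then show ?thesis
    using Q.no_nontrivial_idempotents_quotient_iff unfolding Q_def by blast
qed

lemma lifting_ideal_if_no_nontrivial_idempotents:
  assumes I: "ideal I R"
    and nontriv: "\<And>M. maximalideal M R \<Longrightarrow> no_nontrivial_idempotents (R Quot (I <+> idempotent_part R M))"
  shows "lifting_ideal I R"
  unfolding lifting_ideal_iff[OF I]
proof (intro ballI impI)
  interpret I: ideal I R by fact
  fix f assume f: "f \<in> carrier R" "f \<otimes> f \<ominus> f \<in> I"
  \<comment> \<open>\<open>c\<close> is in \<open>T\<close> when some idempotent lifts
    \<open>f\<close> on the component of \<open>\<one> \<ominus> c\<close>. Thus
    \<open>\<zero> \<in> T\<close> is the goal, and \<open>\<one> \<in> T\<close> concerns the zero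
    component.\<close>
  define T where "T = {c \<in> idempotents R. \<exists>g \<in> idempotents R. (\<one> \<ominus> c) \<otimes> (g \<ominus> f) \<in> I}"
  define N where "N = {x \<in> carrier R. \<exists>c\<in>T. c \<otimes> x = \<zero>}"
  have zero: "\<zero> \<in> idempotents R" and one: "\<one> \<in> idempotents R" by (auto simp: idempotents_iff)
  have N: "ideal N R" unfolding N_def
  proof (rule annihilated_ideal)
    show "T \<subseteq> carrier R" by (auto simp: T_def idempotents_iff)
    have "(\<one> \<ominus> \<one>) \<otimes> (\<zero> \<ominus> f) = \<zero>" using f by (simp add: minus_eq r_neg)
    then have "(\<one> \<ominus> \<one>) \<otimes> (\<zero> \<ominus> f) \<in> I" by simp
    then show "\<one> \<in> T" using zero one unfolding T_def by blast
    fix c d assume cd: "c \<in> T" "d \<in> T"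
    then obtain g h where gh: "g \<in> idempotents R" "(\<one> \<ominus> c) \<otimes> (g \<ominus> f) \<in> I"
      "h \<in> idempotents R" "(\<one> \<ominus> d) \<otimes> (h \<ominus> f) \<in> I" by (auto simp: T_def)
    have car: "c \<in> carrier R" "d \<in> carrier R" "g \<in> carrier R" "h \<in> carrier R" "c \<otimes> c = c"
      using cd gh by (auto simp: T_def idempotents_iff)
    define k where "k = (\<one> \<ominus> c) \<otimes> g \<oplus> c \<otimes> h"
    have k: "k \<in> idempotents R" unfolding k_def using cd gh by (auto simp: T_def intro: glue_idempotents)
    have c0: "c \<ominus> c \<otimes> c = \<zero>" using car by (simp add: minus_eq r_neg)
    \<comment> \<open>The first two summands are the lifting errors of \<open>g\<close> and
      \<open>h\<close>; the third carries the defect of \<open>c\<close>, which is zero.\<close>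
    have "(\<one> \<ominus> c \<otimes> d) \<otimes> (k \<ominus> f)
      = (\<one> \<ominus> c) \<otimes> (g \<ominus> f) \<oplus> c \<otimes> ((\<one> \<ominus> d) \<otimes> (h \<ominus> f)) \<oplus> (c \<ominus> c \<otimes> c) \<otimes> (d \<otimes> (h \<ominus> g))"
      unfolding k_def using car(1-4) f(1) by algebra
    also have "\<dots> \<in> I" using gh car f(1) unfolding c0 by (simp add: I.I_l_closed)
    finally show "c \<otimes> d \<in> T" using k cd by (auto simp: T_def idempotent_mult)
  qed
  have annN: "\<one> \<ominus> c \<in> N" if "c \<in> T" for c
    using that idempotent_mult_complement by (auto simp: N_def T_def idempotents_iff)
  have "\<one> \<in> N"
  proof (rule ccontr)
    assume "\<one> \<notin> N"
    then obtain M where M: "maximalideal M R" "N \<subseteq> M" using proper_ideal_maximal[OF N] by blast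
    interpret M: maximalideal M R by fact
    interpret P: ideal "idempotent_part R M" R by (rule idempotent_part_ideal)
    interpret Q: ideal "I <+> idempotent_part R M :: 'a set" R by (rule add_ideals) unfold_locales
    have "f \<otimes> f \<ominus> f = (f \<otimes> f \<ominus> f) \<oplus> \<zero>" using f by simp
    then have "f \<otimes> f \<ominus> f \<in> I <+> idempotent_part R M"
      unfolding set_add_iff using f(2) P.zero_closed by metis
    then have "f \<in> I <+> idempotent_part R M \<or> f \<ominus> \<one> \<in> I <+> idempotent_part R M"
      using nontriv[OF M(1)] f(1) Q.no_nontrivial_idempotents_quotient_iff by blast
    \<comment> \<open>In both alternatives \<open>f\<close> is congruent to an idempotent
      \<open>g\<close>, namely zero or one.\<close>
    moreover have "f \<ominus> \<zero> = f" using f by (simp add: minus_eq)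
    ultimately obtain g where g: "g \<in> idempotents R" "f \<ominus> g \<in> I <+> idempotent_part R M"
      using zero one by metis
    then obtain i x where ix: "i \<in> I" "x \<in> idempotent_part R M" "f \<ominus> g = i \<oplus> x"
      unfolding set_add_iff by blast
    obtain c where c: "c \<in> idempotents R" "\<one> \<ominus> c \<in> M" "c \<otimes> x = \<zero>"
      using idempotent_part_annihilated[OF M.ideal_axioms ix(2)] .
    have car: "c \<in> carrier R" "g \<in> carrier R" using c g by (auto simp: idempotents_iff)
    have cc: "\<one> \<ominus> (\<one> \<ominus> c) = c" using car by algebra
    \<comment> \<open>Since \<open>c\<close> kills \<open>x\<close>, this \<open>g\<close> lifts
      \<open>f\<close> on the component of \<open>c\<close>, which puts
      \<open>\<one> \<ominus> c\<close> in \<open>T\<close>.\<close>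
    have "c \<otimes> (g \<ominus> f) = \<ominus> (c \<otimes> (f \<ominus> g))" using car f(1) by algebra
    also have "\<dots> = \<ominus> (c \<otimes> i)"
      using c(3) car I.Icarr[OF ix(1)] P.Icarr[OF ix(2)] by (simp add: ix(3) r_distr)
    also have "\<dots> \<in> I" using ix car by (simp add: I.I_l_closed)
    finally have "\<one> \<ominus> c \<in> T" using c g complement_idempotent by (auto simp: T_def cc)
    \<comment> \<open>By \<open>annN\<close>, \<open>c\<close> is in \<open>N\<close> and so in
      \<open>M\<close>, which already contains \<open>\<one> \<ominus> c\<close>.\<close>
    then have "c \<in> M" using annN[of "\<one> \<ominus> c"] M(2) by (auto simp: cc)
    moreover have "\<one> = (\<one> \<ominus> c) \<oplus> c" using car by algebra
    ultimately have "\<one> \<in> M" using c M.a_closed by metis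
    then show False using M.one_imp_carrier M.I_notcarr by blast
  qed
  \<comment> \<open>An element of \<open>T\<close> that annihilates \<open>\<one>\<close> must be
    \<open>\<zero>\<close>.\<close>
  then have "\<zero> \<in> T" by (auto simp: N_def T_def idempotents_iff)
  then obtain g where g: "g \<in> idempotents R" "(\<one> \<ominus> \<zero>) \<otimes> (g \<ominus> f) \<in> I" by (auto simp: T_def)
  then have "g \<ominus> f \<in> I" using f by (simp add: minus_eq idempotents_iff)
  then show "\<exists>e \<in> idempotents R. e \<ominus> f \<in> I" using g by blast
qed

end

theorem theorem3p18:
  fixes R :: "('a, 'm) ring_scheme" (structure) and I :: "'a set"
  assumes "cring R" and "ideal I R"
  shows
    "(lifting_ideal I R \<longleftrightarrow>
        (\<forall>J\<^sub>1 J\<^sub>2. coprime_ideals R J\<^sub>1 J\<^sub>2 \<and> J\<^sub>1 \<cdot> J\<^sub>2 \<subseteq> I \<longrightarrow>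
          (\<exists>e \<in> idempotents R. e \<in> I <+> J\<^sub>1 \<and> \<one> \<ominus> e \<in> I <+> J\<^sub>2)))
     \<and> (lifting_ideal I R \<longleftrightarrow>
        (\<forall>J\<^sub>1 J\<^sub>2. coprime_ideals R J\<^sub>1 J\<^sub>2 \<and> I = J\<^sub>1 \<cdot> J\<^sub>2 \<longrightarrow>
          (\<exists>e \<in> idempotents R. e \<in> J\<^sub>1 \<and> \<one> \<ominus> e \<in> J\<^sub>2)))
     \<and> (lifting_ideal I R \<longleftrightarrow>
        lifts_idempotents R (UP R Quot eval0_kernel R I)
          (\<lambda>r. eval0_kernel R I +>\<^bsub>UP R\<^esub> monom (UP R) r 0))
     \<and> (lifting_ideal I R \<longleftrightarrow>
        (\<forall>\<mm>. maximalideal \<mm> R \<longrightarrow>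
          no_nontrivial_idempotents (R Quot (I <+> idempotent_part R \<mm>))))"
proof -
  interpret cring R by fact
  note I = assms(2)
  \<comment> \<open>A product of ideals lies in both factors, so adding \<open>I\<close> to
    \<open>J\<close> or \<open>K\<close> changes nothing and (ii) specialises to (iii).\<close>
  have iii_if_ii: "\<exists>e \<in> idempotents R. e \<in> J \<and> \<one> \<ominus> e \<in> K"
    if "\<exists>e \<in> idempotents R. e \<in> I <+> J \<and> \<one> \<ominus> e \<in> I <+> K" "coprime_ideals R J K" "I = J \<cdot> K" for J K
  proof -
    have JK: "ideal J R" "ideal K R" using that(2) by (auto simp: coprime_ideals_def)
    have "I \<subseteq> J" "I \<subseteq> K" using ideal_prod_inter[OF JK] that(3) by auto
    then show ?thesis using that(1) by (simp add: ideal_add_absorb[OF I] JK)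
  qed
  show ?thesis
  proof (intro conjI)
    let ?ii = "\<forall>J\<^sub>1 J\<^sub>2. coprime_ideals R J\<^sub>1 J\<^sub>2 \<and> J\<^sub>1 \<cdot> J\<^sub>2 \<subseteq> I \<longrightarrow>
          (\<exists>e \<in> idempotents R. e \<in> I <+> J\<^sub>1 \<and> \<one> \<ominus> e \<in> I <+> J\<^sub>2)"
    let ?iii = "\<forall>J\<^sub>1 J\<^sub>2. coprime_ideals R J\<^sub>1 J\<^sub>2 \<and> I = J\<^sub>1 \<cdot> J\<^sub>2 \<longrightarrow>
          (\<exists>e \<in> idempotents R. e \<in> J\<^sub>1 \<and> \<one> \<ominus> e \<in> J\<^sub>2)"
    have "lifting_ideal I R \<Longrightarrow> ?ii" using lifting_ideal_imp_coprime[OF I] by blast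
    moreover have "?ii \<Longrightarrow> ?iii" using iii_if_ii by blast
    moreover have "?iii \<Longrightarrow> lifting_ideal I R" by (rule lifting_ideal_if_coprime[OF I]) blast
    ultimately show "lifting_ideal I R \<longleftrightarrow> ?ii" "lifting_ideal I R \<longleftrightarrow> ?iii" by argo+
  qed (use lifting_ideal_iff_eval0_kernel[OF I] lifting_ideal_imp_no_nontrivial_idempotents[OF I]
      lifting_ideal_if_no_nontrivial_idempotents[OF I] in blast)+
qed

end
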